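(* Let $a_1,a_2,a_3,a_4\in\mathbb{Z}$ be such that $E: y^2+a_1xy+a_3y=x^3+a_2x^2+a_4x$ is an elliptic curve over $\mathbb{Q}$. Let $z=-x/y$ be the local parameter at the origin $O_E$. Then the $z$-power series expansion of the invariant differential $\omega_E$ is $\omega_E=\sum_{n=0}^{\infty}b(n+1)\,z^n\,dz$, where for every $n\ge 0$, \[b(n+1)=\sum_{m=\lfloor n/2\rfloor}^{n}\sum_{k=0}^{\lfloor m/2\rfloor}\sum_{r=0}^{n-m-k}\binom{m}{k}\binom{m-k}{k}\binom{m-2k}{r}\binom{k}{n-m-k-r}a_1^{m-2k-r}a_2^{r}a_3^{2k-n+m+r}a_4^{n-m-k-r}.\]
   Context: Setting $z=-x/y$ and $w=-1/y$, the Weierstrass equation becomes $w=z^3+a_1zw+a_2z^2w+a_3w^2+a_4zw^2$, which has a unique formal power series solution $w(z)=z^3+O(z^4)\in\mathbb{Z}[a_1,\dots,a_4]\llbracket z\rrbracket$. Then $x(z)=z/w(z)$ and $y(z)=-1/w(z)$ are Laurent series, and the invariant differential $\omega_E=\frac{dy}{3x^2+2a_2x+a_4-a_1y}=\frac{dx}{2y+a_1x+a_3}$ is expanded as a power series in $z$ times $dz$ by substituting these series. Binomial coefficients $\binom{a}{j}$ with $a\ge0$ are zero when $j<0$ or $j>a$ and empty sums are zero; any summand whose binomial coefficient product vanishes is interpreted as $0$. *)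

theory Defs
  imports
    "HOL-Computational_Algebra.Formal_Laurent_Series"
    "HOL-Algebra.Algebraic_Closure_Type"
begin

text \<open>
  Throughout, \<open>a1 a2 a3 a4\<close> are the coefficients of the affine equation
  \<open>y\<^sup>2 + a1 x y + a3 y = x\<^sup>3 + a2 x\<^sup>2 + a4 x\<close>, and
  \<open>weierstrass_form\<close> is its homogenisation in coordinates
  \<open>[x:y:t]\<close>, followed by its three partial derivatives.
\<close>

definition weierstrass_form ::
  "'a::comm_ring_1 \<Rightarrow> 'a \<Rightarrow> 'a \<Rightarrow> 'a \<Rightarrow> 'a \<Rightarrow> 'a \<Rightarrow> 'a \<Rightarrow> 'a" where
  "weierstrass_form a1 a2 a3 a4 x y t =
     y^2 * t + a1 * x * y * t + a3 * y * t^2 - (x^3 + a2 * x^2 * t + a4 * x * t^2)"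

definition weierstrass_form_dx ::
  "'a::comm_ring_1 \<Rightarrow> 'a \<Rightarrow> 'a \<Rightarrow> 'a \<Rightarrow> 'a \<Rightarrow> 'a \<Rightarrow> 'a \<Rightarrow> 'a" where
  "weierstrass_form_dx a1 a2 a3 a4 x y t =
     a1 * y * t - (3 * x^2 + 2 * a2 * x * t + a4 * t^2)"

definition weierstrass_form_dy ::
  "'a::comm_ring_1 \<Rightarrow> 'a \<Rightarrow> 'a \<Rightarrow> 'a \<Rightarrow> 'a \<Rightarrow> 'a \<Rightarrow> 'a \<Rightarrow> 'a" where
  "weierstrass_form_dy a1 a2 a3 a4 x y t =
     2 * y * t + a1 * x * t + a3 * t^2"

definition weierstrass_form_dt ::
  "'a::comm_ring_1 \<Rightarrow> 'a \<Rightarrow> 'a \<Rightarrow> 'a \<Rightarrow> 'a \<Rightarrow> 'a \<Rightarrow> 'a \<Rightarrow> 'a" where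
  "weierstrass_form_dt a1 a2 a3 a4 x y t =
     y^2 + a1 * x * y + 2 * a3 * y * t - (a2 * x^2 + 2 * a4 * x * t)"

text \<open>
  A plane cubic in Weierstrass form over a field is an elliptic curve (with origin
  \<open>[0:1:0]\<close>) iff it is smooth, i.e. has no singular point over the algebraic closure.
\<close>

definition elliptic_curve :: "'a::field \<Rightarrow> 'a \<Rightarrow> 'a \<Rightarrow> 'a \<Rightarrow> bool" where
  "elliptic_curve a1 a2 a3 a4 \<longleftrightarrow>
     (\<forall>x y t :: 'a alg_closure.
        (x, y, t) \<noteq> (0, 0, 0) \<longrightarrow>
        weierstrass_form (to_ac a1) (to_ac a2) (to_ac a3) (to_ac a4) x y t = 0 \<longrightarrow>
        \<not> (weierstrass_form_dx (to_ac a1) (to_ac a2) (to_ac a3) (to_ac a4) x y t = 0 \<and>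
           weierstrass_form_dy (to_ac a1) (to_ac a2) (to_ac a3) (to_ac a4) x y t = 0 \<and>
           weierstrass_form_dt (to_ac a1) (to_ac a2) (to_ac a3) (to_ac a4) x y t = 0))"

text \<open>
  In the coordinates \<open>z = -x/y\<close>, \<open>w = -1/y\<close>; the variable \<open>z\<close> is \<^const>\<open>fps_X\<close>,
  and the second conjunct says \<open>w = z\<^sup>3 + O(z\<^sup>4)\<close>.
\<close>

definition is_w_series :: "'a::comm_ring_1 \<Rightarrow> 'a \<Rightarrow> 'a \<Rightarrow> 'a \<Rightarrow> 'a fps \<Rightarrow> bool" where
  "is_w_series a1 a2 a3 a4 w \<longleftrightarrow>
     w = fps_X^3 + fps_const a1 * fps_X * w + fps_const a2 * fps_X^2 * w
           + fps_const a3 * w^2 + fps_const a4 * fps_X * w^2 \<and>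
     (\<forall>n<4. fps_nth w n = fps_nth (fps_X^3) n)"

definition w_series :: "'a::comm_ring_1 \<Rightarrow> 'a \<Rightarrow> 'a \<Rightarrow> 'a \<Rightarrow> 'a fps" where
  "w_series a1 a2 a3 a4 = (THE w. is_w_series a1 a2 a3 a4 w)"

definition x_series :: "'a::field \<Rightarrow> 'a \<Rightarrow> 'a \<Rightarrow> 'a \<Rightarrow> 'a fls" where
  "x_series a1 a2 a3 a4 = fls_X / fps_to_fls (w_series a1 a2 a3 a4)"

definition y_series :: "'a::field \<Rightarrow> 'a \<Rightarrow> 'a \<Rightarrow> 'a \<Rightarrow> 'a fls" where
  "y_series a1 a2 a3 a4 = - 1 / fps_to_fls (w_series a1 a2 a3 a4)"

text \<open>
  A differential \<open>f dz\<close> is represented by its coefficient \<open>f\<close>, so that \<open>dx\<close> becomes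
  the formal derivative of \<open>x(z)\<close>. The other expression
  \<open>dy / (3x\<^sup>2 + 2 a2 x + a4 - a1 y)\<close> is treated in \<open>invariant_differential_alt\<close> below.
\<close>

definition invariant_differential :: "'a::field \<Rightarrow> 'a \<Rightarrow> 'a \<Rightarrow> 'a \<Rightarrow> 'a fls" where
  "invariant_differential a1 a2 a3 a4 =
     (let x = x_series a1 a2 a3 a4; y = y_series a1 a2 a3 a4
      in fls_deriv x / (2 * y + fls_const a1 * x + fls_const a3))"


lemma fps_nth_square_reduced:
  fixes w :: "'a::comm_ring_1 fps"
  assumes "fps_nth w 0 = 0"
  shows "fps_nth (w^2) n = (\<Sum>i=1..<n. fps_nth w i * fps_nth w (n - i))"
proof -
  have "fps_nth (w^2) n = (\<Sum>i=0..n. fps_nth w i * fps_nth w (n - i))"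
    by (simp add: power2_eq_square fps_mult_nth)
  also have "\<dots> = (\<Sum>i=1..<n. fps_nth w i * fps_nth w (n - i))"
    using assms by (intro sum.mono_neutral_right) (auto simp: Suc_le_eq le_less)
  finally show ?thesis .
qed

lemma w_equation_nth:
  fixes w :: "'a::comm_ring_1 fps"
  assumes "fps_nth w 0 = 0"
  shows "fps_nth (fps_X^3 + fps_const a1 * fps_X * w + fps_const a2 * fps_X^2 * w
           + fps_const a3 * w^2 + fps_const a4 * fps_X * w^2) n =
     (if n = 3 then 1 else 0)
       + (if n < 1 then 0 else a1 * fps_nth w (n - 1))
       + (if n < 2 then 0 else a2 * fps_nth w (n - 2))
       + a3 * (\<Sum>i=1..<n. fps_nth w i * fps_nth w (n - i))
       + a4 * (\<Sum>i=1..<n - 1. fps_nth w i * fps_nth w (n - 1 - i))"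
  using fps_nth_square_reduced[OF assms]
  by (auto simp: mult.assoc fps_X_power_mult_nth)

lemma is_w_series_unique:
  fixes v w :: "'a::comm_ring_1 fps"
  assumes "is_w_series a1 a2 a3 a4 v" "is_w_series a1 a2 a3 a4 w"
  shows "v = w"
proof (rule fps_ext)
  fix n
  have v0: "fps_nth v 0 = 0" and w0: "fps_nth w 0 = 0"
    using assms by (auto simp: is_w_series_def)
  show "fps_nth v n = fps_nth w n"
  proof (induction n rule: less_induct)
    case (less n)
    have sv: "(\<Sum>i=1..<m. fps_nth v i * fps_nth v (m - i)) =
              (\<Sum>i=1..<m. fps_nth w i * fps_nth w (m - i))" if "m \<le> n" for m
      using that by (intro sum.cong refl arg_cong2[where f = "(*)"] less) auto
    have "fps_nth v n = fps_nth (fps_X^3 + fps_const a1 * fps_X * v + fps_const a2 * fps_X^2 * v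
           + fps_const a3 * v^2 + fps_const a4 * fps_X * v^2) n"
      using assms(1) unfolding is_w_series_def by metis
    also have "\<dots> = fps_nth (fps_X^3 + fps_const a1 * fps_X * w + fps_const a2 * fps_X^2 * w
           + fps_const a3 * w^2 + fps_const a4 * fps_X * w^2) n"
      unfolding w_equation_nth[OF v0] w_equation_nth[OF w0]
      using sv[of n] sv[of "n - 1"] less[of "n - 1"] less[of "n - 2"] by auto
    also have "\<dots> = fps_nth w n"
      using assms(2) unfolding is_w_series_def by metis
    finally show ?case .
  qed
qed

fun w_coeff :: "'a::comm_ring_1 \<Rightarrow> 'a \<Rightarrow> 'a \<Rightarrow> 'a \<Rightarrow> nat \<Rightarrow> 'a" where
  [simp del]: "w_coeff a1 a2 a3 a4 n =
     (if n = 3 then 1 else 0)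
       + (if n < 1 then 0 else a1 * w_coeff a1 a2 a3 a4 (n - 1))
       + (if n < 2 then 0 else a2 * w_coeff a1 a2 a3 a4 (n - 2))
       + a3 * (\<Sum>i=1..<n. w_coeff a1 a2 a3 a4 i * w_coeff a1 a2 a3 a4 (n - i))
       + a4 * (\<Sum>i=1..<n - 1. w_coeff a1 a2 a3 a4 i * w_coeff a1 a2 a3 a4 (n - 1 - i))"

lemma is_w_series_w_coeff: "is_w_series a1 a2 a3 a4 (Abs_fps (w_coeff a1 a2 a3 a4))"
proof -
  let ?c = "w_coeff a1 a2 a3 a4"
  have c0: "?c 0 = 0" by (subst w_coeff.simps) simp
  have c1: "?c 1 = 0" by (subst w_coeff.simps) (simp add: c0)
  have c2: "?c 2 = 0" by (subst w_coeff.simps) (use c0 c1 in \<open>simp add: numeral_2_eq_2\<close>)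
  have "{1..<3::nat} = {1, 2}" "{1..<2::nat} = {1}" by auto
  then have c3: "?c 3 = 1" by (subst w_coeff.simps) (use c1 c2 in simp)
  have "Abs_fps ?c = fps_X^3 + fps_const a1 * fps_X * Abs_fps ?c
      + fps_const a2 * fps_X^2 * Abs_fps ?c
      + fps_const a3 * (Abs_fps ?c)^2 + fps_const a4 * fps_X * (Abs_fps ?c)^2"
  proof (rule fps_ext)
    fix n
    have "fps_nth (Abs_fps ?c) 0 = 0" by (simp add: c0)
    from w_equation_nth[OF this, of a1 a2 a3 a4 n]
    show "fps_nth (Abs_fps ?c) n = fps_nth (fps_X^3 + fps_const a1 * fps_X * Abs_fps ?c
        + fps_const a2 * fps_X^2 * Abs_fps ?c
        + fps_const a3 * (Abs_fps ?c)^2 + fps_const a4 * fps_X * (Abs_fps ?c)^2) n"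
      using w_coeff.simps[of a1 a2 a3 a4 n] by (simp only: fps_nth_Abs_fps)
  qed
  moreover have "\<forall>n<4. fps_nth (Abs_fps ?c) n = fps_nth (fps_X^3) n"
    using c0 c1 c2 c3 by (auto simp: less_Suc_eq numeral_eq_Suc)
  ultimately show ?thesis unfolding is_w_series_def by blast
qed

lemma ex1_w_series: "\<exists>!w. is_w_series a1 a2 a3 a4 w"
  using is_w_series_w_coeff is_w_series_unique by blast

lemma is_w_series_w_series: "is_w_series a1 a2 a3 a4 (w_series a1 a2 a3 a4)"
  unfolding w_series_def by (rule theI'[OF ex1_w_series])

lemma w_series_nonzero: "w_series a1 a2 a3 a4 \<noteq> 0"
proof
  assume "w_series a1 a2 a3 a4 = 0"
  moreover have "fps_nth (w_series a1 a2 a3 a4) 3 = fps_nth (fps_X^3) 3"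
    using is_w_series_w_series[of a1 a2 a3 a4] unfolding is_w_series_def by simp
  ultimately show False by simp
qed

lemma weierstrass_equation_series:
  fixes a1 a2 a3 a4 :: "'a::field"
  defines "x \<equiv> x_series a1 a2 a3 a4" and "y \<equiv> y_series a1 a2 a3 a4"
  shows "y^2 + fls_const a1 * x * y + fls_const a3 * y =
         x^3 + fls_const a2 * x^2 + fls_const a4 * x"
    and "- x / y = fls_X"
proof -
  define w where "w = fps_to_fls (w_series a1 a2 a3 a4)"
  have w0: "w \<noteq> 0" by (simp add: w_def w_series_nonzero)
  have x: "x = fls_X / w" and y: "y = - 1 / w"
    by (simp_all add: x_def y_def w_def x_series_def y_series_def)
  have "w_series a1 a2 a3 a4 =
      fps_X^3 + fps_const a1 * fps_X * w_series a1 a2 a3 a4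
        + fps_const a2 * fps_X^2 * w_series a1 a2 a3 a4
        + fps_const a3 * (w_series a1 a2 a3 a4)^2
        + fps_const a4 * fps_X * (w_series a1 a2 a3 a4)^2"
    using is_w_series_w_series[of a1 a2 a3 a4] unfolding is_w_series_def by blast
  from arg_cong[OF this, of fps_to_fls]
  have "w = fls_X^3 + fls_const a1 * fls_X * w + fls_const a2 * fls_X^2 * w
          + fls_const a3 * w^2 + fls_const a4 * fls_X * w^2"
    by (simp add: w_def fls_times_fps_to_fls fps_to_fls_power)
  then have eq: "w - fls_const a1 * fls_X * w - fls_const a3 * w^2 =
      fls_X^3 + fls_const a2 * fls_X^2 * w + fls_const a4 * fls_X * w^2"
    by (simp add: algebra_simps)
  have "y^2 + fls_const a1 * x * y + fls_const a3 * y =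
      (w - fls_const a1 * fls_X * w - fls_const a3 * w^2) / w^3"
    unfolding x y using w0 by (simp add: field_simps power2_eq_square power3_eq_cube)
  also have "\<dots> = x^3 + fls_const a2 * x^2 + fls_const a4 * x"
    unfolding x eq using w0 by (simp add: field_simps power2_eq_square power3_eq_cube)
  finally show "y^2 + fls_const a1 * x * y + fls_const a3 * y =
         x^3 + fls_const a2 * x^2 + fls_const a4 * x" .
  show "- x / y = fls_X" unfolding x y using w0 by simp
qed

lemma invariant_differential_alt:
  fixes a1 a2 a3 a4 :: "'a::field_char_0"
  defines "x \<equiv> x_series a1 a2 a3 a4" and "y \<equiv> y_series a1 a2 a3 a4"
  shows "2 * y + fls_const a1 * x + fls_const a3 \<noteq> 0"
    and "3 * x^2 + 2 * fls_const a2 * x + fls_const a4 - fls_const a1 * y \<noteq> 0"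
    and "invariant_differential a1 a2 a3 a4 =
         fls_deriv y / (3 * x^2 + 2 * fls_const a2 * x + fls_const a4 - fls_const a1 * y)"
proof -
  let ?D = "2 * y + fls_const a1 * x + fls_const a3"
  let ?D' = "3 * x^2 + 2 * fls_const a2 * x + fls_const a4 - fls_const a1 * y"
  define v where "v = w_series a1 a2 a3 a4"
  define w where "w = fps_to_fls v"
  have v: "fps_nth v 0 = 0" "fps_nth v 3 = 1"
    using is_w_series_w_series[of a1 a2 a3 a4] by (auto simp: v_def is_w_series_def)
  have w0: "w \<noteq> 0" by (simp add: w_def v_def w_series_nonzero)
  have x: "x = fls_X / w" and y: "y = - 1 / w"
    by (simp_all add: x_def y_def w_def v_def x_series_def y_series_def)
  have "fps_nth (- 2 + fps_const a1 * fps_X + fps_const a3 * v) 0 \<noteq> 0"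
    using v by simp
  then have "- 2 + fps_const a1 * fps_X + fps_const a3 * v \<noteq> 0"
    by (metis fps_zero_nth)
  then have "fps_to_fls (- 2 + fps_const a1 * fps_X + fps_const a3 * v) \<noteq> 0"
    by (simp only: fps_to_fls_eq_0_iff not_False_eq_True)
  moreover have "fps_to_fls (- 2 + fps_const a1 * fps_X + fps_const a3 * v) =
      - 2 + fls_const a1 * fls_X + fls_const a3 * w"
    by (simp add: w_def fls_times_fps_to_fls)
  moreover have "?D = (- 2 + fls_const a1 * fls_X + fls_const a3 * w) / w"
    unfolding x y using w0 by (simp add: field_simps)
  ultimately show D: "?D \<noteq> 0" using w0 by (metis divide_eq_0_iff)
  have "fls_deriv (y^2 + fls_const a1 * x * y + fls_const a3 * y) =
        fls_deriv (x^3 + fls_const a2 * x^2 + fls_const a4 * x)"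
    unfolding x_def y_def weierstrass_equation_series(1) ..
  then have eq: "?D * fls_deriv y = ?D' * fls_deriv x"
    by (simp add: power2_eq_square power3_eq_cube algebra_simps)
  have "fps_nth (fps_deriv v) 2 \<noteq> 0" using v by simp
  then have "fls_deriv w \<noteq> 0"
    unfolding w_def fls_deriv_fps_to_fls by (metis fps_to_fls_eq_0_iff fps_zero_nth)
  have "y * w = - 1" unfolding y using w0 by simp
  then have "fls_deriv (y * w) = 0" by simp
  then have "y * fls_deriv w + fls_deriv y * w = 0" by simp
  moreover have "y * fls_deriv w \<noteq> 0"
    using \<open>fls_deriv w \<noteq> 0\<close> w0 by (simp add: y)
  ultimately have "fls_deriv y \<noteq> 0" by auto
  with D eq show D': "?D' \<noteq> 0" by auto
  have "invariant_differential a1 a2 a3 a4 = fls_deriv x / ?D"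
    by (simp add: invariant_differential_def x_def y_def Let_def)
  also have "\<dots> = fls_deriv y / ?D'"
    using D D' eq by (simp add: frac_eq_eq mult.commute)
  finally show "invariant_differential a1 a2 a3 a4 = fls_deriv y / ?D'" .
qed

end

theory Submission
  imports Defs
begin

text \<open>
  Put \<open>A = a1 z + a2 z\<^sup>2\<close> and \<open>C = a3 + a4 z\<close>, so that \<open>w = z\<^sup>3 + A w + C w\<^sup>2\<close>.
  Differentiating this equation shows that the invariant differential is \<open>dz / S\<close> with
  \<open>S = 1 - A - 2 C w\<close>, and solving the quadratic equation for \<open>w\<close> gives
  \<open>S\<^sup>2 = (1 - A)\<^sup>2 - 4 C z\<^sup>3\<close>. Since \<open>1 / sqrt (1 - 4 u)\<close> is the generating function of the
  central binomial coefficients, \<open>1 / S\<close> is the sum over \<open>k\<close> of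
  \<open>binom(2k, k) (C z\<^sup>3)\<^sup>k / (1 - A)\<^bsup>2k+1\<^esup>\<close>. Expanding \<open>1 / (1 - A)\<^bsup>2k+1\<^esup>\<close>, \<open>A\<^sup>j\<close> and \<open>C\<^sup>k\<close>
  and collecting terms with \<open>m = 2k + j\<close> gives the formula.
\<close>

unbundle fps_syntax

section \<open>Central binomial coefficients and the series 1 / sqrt (1 - 4 u)\<close>

text \<open>Both sides equal 1 at k = 0 and satisfy (k + 1) c(k + 1) = 2 (2 k + 1) c(k).\<close>

lemma central_binomial_eq_gbinomial:
  "of_nat ((2 * k) choose k) = (- 4) ^ k * ((- 1 / 2 :: 'a::field_char_0) gchoose k)"
proof (induction k)
  case (Suc k)
  have "(k + 1) * ((2 * Suc k) choose Suc k) = 2 * (2 * k + 1) * ((2 * k) choose k)"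
  proof -
    have "Suc k * (Suc (Suc (2 * k)) choose Suc k) = Suc (Suc (2 * k)) * (Suc (2 * k) choose k)"
      by (rule Suc_times_binomial_eq[symmetric, simplified mult.commute])
    moreover have "Suc k * (Suc (2 * k) choose k) = Suc (2 * k) * ((2 * k) choose k)"
      using Suc_times_binomial_eq[of "2 * k" k] binomial_symmetric[of k "Suc (2 * k)"]
      by (simp add: mult.commute del: binomial_Suc_Suc)
    \<comment> \<open>Two absorption steps descend from row 2 k + 2 to row 2 k; each contributes a
      factor k + 1, and one of them is cancelled afterwards.\<close>
    ultimately have "Suc k * (Suc k * (Suc (Suc (2 * k)) choose Suc k)) =
        Suc k * (2 * (2 * k + 1) * ((2 * k) choose k))"
      by (metis (no_types, lifting) Suc_eq_plus1 mult.assoc mult.left_commute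
          mult_2 add_Suc_right add_Suc)
    then show ?thesis by (metis Suc_eq_plus1 Suc_mult_cancel1 mult_Suc_right add_2_eq_Suc)
  qed
  from arg_cong[OF this, of "of_nat :: nat \<Rightarrow> 'a"] Suc
  have "(of_nat k + 1) * of_nat ((2 * Suc k) choose Suc k) =
      2 * (2 * of_nat k + 1) * ((- 4) ^ k * ((- 1 / 2 :: 'a) gchoose k))"
    by (simp only: of_nat_mult of_nat_add of_nat_1 of_nat_numeral)
  also have "\<dots> = (of_nat k + 1) * ((- 4) ^ Suc k * ((- 1 / 2 :: 'a) gchoose Suc k))"
  proof -
    have G: "(of_nat k + 1) * ((- 1 / 2 :: 'a) gchoose Suc k) =
        (- 1 / 2 - of_nat k) * ((- 1 / 2) gchoose k)"
      using gbinomial_mult_1[of "- 1 / 2 :: 'a" k] by (simp add: algebra_simps)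
    have "(of_nat k + 1) * ((- 4) ^ Suc k * ((- 1 / 2 :: 'a) gchoose Suc k)) =
        (- 4) ^ Suc k * ((of_nat k + 1) * ((- 1 / 2 :: 'a) gchoose Suc k))"
      by (rule mult.left_commute)
    also have "\<dots> = 2 * (2 * of_nat k + 1) * ((- 4) ^ k * ((- 1 / 2 :: 'a) gchoose k))"
      unfolding G by (simp add: algebra_simps)
    finally show ?thesis by (rule sym)
  qed
  finally show ?case
    by (rule mult_left_cancel[THEN iffD1, rotated]) (metis add.commute of_nat_Suc of_nat_neq_0)
qed simp

text \<open>\<open>H\<close> and 1 - 4 X arise from (1 + X)^(-1/2) and (1 + X)^1 by substituting -4
  X, and the exponents add up: 2 (-1/2) + 1 = 0.\<close>

lemma central_binomial_series_sqr:
  fixes H :: "'a::field_char_0 fps"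
  defines "H \<equiv> Abs_fps (\<lambda>k. of_nat ((2 * k) choose k))"
  shows "H\<^sup>2 * (1 - 4 * fps_X) = 1"
proof -
  have H: "H = fps_binomial (- 1 / 2) oo (fps_const (- 4) * fps_X)"
    by (simp add: fps_eq_iff H_def central_binomial_eq_gbinomial)
  have L: "1 - 4 * fps_X = fps_binomial 1 oo (fps_const (- 4 :: 'a) * fps_X)"
    by (simp add: fps_binomial_1 fps_compose_add_distrib numeral_fps_const
        del: fps_const_neg flip: fps_const_neg)
  show ?thesis unfolding H L
    by (simp add: fps_compose_power fps_binomial_power
        flip: fps_compose_mult_distrib fps_binomial_add_mult)
qed

section \<open>Coefficients of composed series and of powers\<close>

text \<open>Since \<open>b\<close> has no constant term, \<open>b ^ i\<close> starts in degree at
  least i. One bound \<open>N\<close> therefore serves all coefficients up to n, and the two sums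
  can be swapped.\<close>

lemma fps_mult_compose_nth:
  fixes u f b :: "'a::idom fps"
  assumes "b $ 0 = 0" "n \<le> N"
  shows "(u * (f oo b)) $ n = (\<Sum>i\<le>N. f $ i * (u * b ^ i) $ n)"
proof -
  have "(f oo b) $ l = (\<Sum>i\<le>N. f $ i * (b ^ i) $ l)" if "l \<le> N" for l
    unfolding fps_compose_nth using that assms(1)
    by (intro sum.mono_neutral_left) (auto simp: startsby_zero_power_prefix)
  then have "(u * (f oo b)) $ n = (\<Sum>l=0..n. u $ l * (\<Sum>i\<le>N. f $ i * (b ^ i) $ (n - l)))"
    using assms(2) by (auto simp: fps_mult_nth intro!: sum.cong)
  also have "\<dots> = (\<Sum>i\<le>N. f $ i * (u * b ^ i) $ n)"
    unfolding fps_mult_nth sum_distrib_left by (subst sum.swap) (simp add: mult_ac)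
  finally show ?thesis .
qed

text \<open>The negative binomial series for exponent p + 1, with \<open>A\<close> substituted for
  the variable.\<close>

lemma inverse_one_minus_power_compose:
  fixes A :: "'a::field_char_0 fps"
  assumes "A $ 0 = 0"
  shows "inverse (1 - A) ^ Suc p = Abs_fps (\<lambda>j. of_nat ((p + j) choose j)) oo A"
proof -
  have "Abs_fps (\<lambda>j. of_nat ((p + j) choose j)) = inverse ((1 - fps_X :: 'a fps) ^ Suc p)"
    using one_minus_const_fps_X_neg_power'[of "Suc p" "1 :: 'a"] by simp
  then show ?thesis using assms
    by (simp add: fps_inverse_compose fps_compose_sub_distrib fps_inverse_power
        flip: fps_compose_power del: power_Suc)
qed

text \<open>For r > j the truncated exponent \<open>j - r\<close> is harmless, because the binomial
  coefficient is 0.\<close>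

lemma fps_linear_power_nth:
  fixes a b :: "'a::comm_ring_1"
  shows "((fps_const a + fps_const b * fps_X) ^ j) $ r = of_nat (j choose r) * a ^ (j - r) * b ^ r"
proof -
  have "((fps_const b * fps_X + fps_const a) ^ j) $ r
     = (\<Sum>i\<le>j. if i = r then of_nat (j choose r) * a ^ (j - r) * b ^ r else 0)"
    unfolding binomial_ring fps_sum_nth
    by (intro sum.cong) (auto simp: power_mult_distrib fps_const_power fps_of_nat[symmetric]
        mult.assoc fps_X_power_mult_right_nth
        mult.left_commute[of "fps_X ^ _"] mult.commute)
  then show ?thesis by (simp add: add.commute binomial_eq_0)
qed

text \<open>Both products are the multinomial coefficient (2k+j)! / (k! k! j!). The right-hand form
  is the one that survives the substitution m = 2k + j.\<close>

lemma central_binomial_times_binomial: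
  "((2*k) choose k) * ((2*k+j) choose j) = ((2*k+j) choose k) * ((k+j) choose k)"
  using choose_mult[of k "2*k" "2*k+j"] binomial_symmetric[of j "2*k+j"] by (simp add: mult.commute)

section \<open>The invariant differential in the parameter z\<close>

text \<open>Here \<open>v'\<close> plays the role of \<open>dw/dz\<close>; the second assumption is the derivative of the first.\<close>

lemma w_equation_tangent:
  fixes v v' z a1 a2 a3 a4 :: "'a::comm_ring_1"
  assumes v: "v = z ^ 3 + a1 * z * v + a2 * z\<^sup>2 * v + a3 * v\<^sup>2 + a4 * z * v\<^sup>2"
    and v': "v' = 3 * z\<^sup>2 + a1 * (v + z * v') + a2 * (2 * z * v + z\<^sup>2 * v')
      + a3 * (2 * v * v') + a4 * (v\<^sup>2 + 2 * z * v * v')"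
  shows "(v - z * v') * (1 - a1 * z - a2 * z\<^sup>2 - 2 * (a3 + a4 * z) * v) =
    v * (- 2 + a1 * z + a3 * v)"
proof -
  \<comment> \<open>Three times the equation minus z times its derivative: the combination in which
    z^3 cancels.\<close>
  have "(v - z * v') * (1 - a1 * z - a2 * z\<^sup>2 - 2 * (a3 + a4 * z) * v)
      - v * (- 2 + a1 * z + a3 * v) =
    3 * (v - (z ^ 3 + a1 * z * v + a2 * z\<^sup>2 * v + a3 * v\<^sup>2 + a4 * z * v\<^sup>2))
    - z * (v' - (3 * z\<^sup>2 + a1 * (v + z * v') + a2 * (2 * z * v + z\<^sup>2 * v')
      + a3 * (2 * v * v') + a4 * (v\<^sup>2 + 2 * z * v * v')))"
    by (simp add: algebra_simps power2_eq_square power3_eq_cube)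
  then show ?thesis
    unfolding v[symmetric] v'[symmetric] by simp
qed

text \<open>From x = z / w one gets dx/dz = (w - z w') / w^2, and 2 y + a1 x + a3 = N / w with N =
  -2 + a1 z + a3 w. The tangent identity (w - z w') S = w N turns the quotient into 1 / S.\<close>

lemma invariant_differential_eqI:
  fixes a1 a2 a3 a4 :: "'a::field_char_0" and F :: "'a fps"
  defines "v \<equiv> w_series a1 a2 a3 a4"
  assumes F: "F * (1 - fps_const a1 * fps_X - fps_const a2 * fps_X\<^sup>2
    - 2 * (fps_const a3 + fps_const a4 * fps_X) * v) = 1"
  shows "invariant_differential a1 a2 a3 a4 = fps_to_fls F"
proof -
  define S where "S = 1 - fps_const a1 * fps_X - fps_const a2 * fps_X\<^sup>2
    - 2 * (fps_const a3 + fps_const a4 * fps_X) * v"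
  define N where "N = - 2 + fps_const a1 * fps_X + fps_const a3 * v"
  define x where "x = x_series a1 a2 a3 a4"
  define y where "y = y_series a1 a2 a3 a4"
  define w where "w = fps_to_fls v"
  have v: "v = fps_X^3 + fps_const a1 * fps_X * v + fps_const a2 * fps_X^2 * v
      + fps_const a3 * v^2 + fps_const a4 * fps_X * v^2"
    using is_w_series_w_series[of a1 a2 a3 a4] unfolding is_w_series_def v_def by blast
  have "fps_deriv v = 3 * fps_X\<^sup>2 + fps_const a1 * (v + fps_X * fps_deriv v)
      + fps_const a2 * (2 * fps_X * v + fps_X\<^sup>2 * fps_deriv v)
      + fps_const a3 * (2 * v * fps_deriv v)
      + fps_const a4 * (v\<^sup>2 + 2 * fps_X * v * fps_deriv v)"
    by (subst v) (simp add: power2_eq_square power3_eq_cube algebra_simps)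
  with v have key: "(v - fps_X * fps_deriv v) * S = v * N"
    unfolding S_def N_def by (rule w_equation_tangent)
  have w0: "w \<noteq> 0" by (simp add: w_def v_def w_series_nonzero)
  have x: "x = fls_X / w" and y: "y = - 1 / w"
    by (simp_all add: x_def y_def w_def v_def x_series_def y_series_def)
  let ?D = "2 * y + fls_const a1 * x + fls_const a3"
  have N: "fps_to_fls N = w * ?D"
    unfolding x y N_def using w0 by (simp add: w_def fls_times_fps_to_fls field_simps)
  have D: "?D \<noteq> 0"
    unfolding x_def y_def by (rule invariant_differential_alt(1))
  \<comment> \<open>Differentiating x w = z replaces the quotient rule for x = z / w.\<close>
  have xw: "x * w = fls_X" using w0 by (simp add: x)
  then have "fls_deriv (x * w) = 1" by simp
  then have "fls_deriv x * w = 1 - x * fls_deriv w"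
    by (simp add: algebra_simps)
  from arg_cong[OF this, of "(*) w"] have "w * (fls_deriv x * w) = w - x * w * fls_deriv w"
    by (simp add: right_diff_distrib mult_ac)
  then have "w * (fls_deriv x * w) = w - fls_X * fls_deriv w"
    by (simp only: xw)
  then have "w * (fls_deriv x * w) * fps_to_fls S = w * (w * ?D)"
    using arg_cong[OF key, of fps_to_fls] N
    by (simp add: w_def fls_times_fps_to_fls fls_deriv_fps_to_fls)
  then have "fls_deriv x * fps_to_fls S = ?D"
    using w0 by simp
  then have "(fls_deriv x / ?D) * fps_to_fls S = 1"
    using D by simp
  moreover have "fps_to_fls F * fps_to_fls S = 1"
    using arg_cong[OF F, of fps_to_fls] unfolding S_def[symmetric]
    by (simp add: fls_times_fps_to_fls)
  moreover have "fps_to_fls S \<noteq> 0"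
    using calculation(2) by auto
  ultimately have "fls_deriv x / ?D = fps_to_fls F"
    by (metis mult_cancel_right)
  then show ?thesis
    by (simp add: invariant_differential_def x_def y_def Let_def)
qed

section \<open>Reciprocal square root of the discriminant\<close>

text \<open>Power series over a field form a domain, so f is 1 or -1; the constant term fixes the
  sign. This selects the right branch of the square root.\<close>

lemma fps_eq_1_if_square_eq_1:
  fixes f :: "'a::field_char_0 fps"
  assumes "f\<^sup>2 = 1" "f $ 0 = 1"
  shows "f = 1"
proof -
  have "f \<noteq> -1" using assms(2) by (metis fps_neg_nth fps_one_nth one_neq_neg_one)
  then show ?thesis using assms(1) by (simp add: power2_eq_1_iff)
qed

text \<open>\<open>F\<close> is 1 / sqrt ((1 - A)^2 - 4 T), obtained by pulling (1 - A)^2 out of the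
  root and expanding in \<open>T * U\<^sup>2\<close>. The k-th term carries U^(2k+1), which is then
  expanded in powers of \<open>A\<close>.\<close>

lemma inverse_sqrt_quadratic_series:
  fixes A T :: "'a::field_char_0 fps"
  assumes A0: "A $ 0 = 0" and T0: "T $ 0 = 0"
  defines "U \<equiv> inverse (1 - A)"
  defines "F \<equiv> U * (Abs_fps (\<lambda>k. of_nat ((2 * k) choose k)) oo (T * U\<^sup>2))"
  shows "F\<^sup>2 * ((1 - A)\<^sup>2 - 4 * T) = 1" and "F $ 0 = 1"
    and "F $ n = (\<Sum>k\<le>n. \<Sum>j\<le>n. of_nat (((2*k+j) choose k) * ((k+j) choose k)) * (T ^ k * A ^ j) $ n)"
proof -
  define H :: "'a fps" where "H = Abs_fps (\<lambda>k. of_nat ((2 * k) choose k))"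
  have TU: "(T * U\<^sup>2) $ 0 = 0" using T0 by simp
  have U: "U * (1 - A) = 1"
    unfolding U_def by (rule inverse_mult_eq_1) (simp add: A0)
  have "(H\<^sup>2 * (1 - 4 * fps_X)) oo (T * U\<^sup>2) = 1"
    unfolding H_def central_binomial_series_sqr by simp
  then have "(H oo (T * U\<^sup>2))\<^sup>2 * (1 - 4 * (T * U\<^sup>2)) = 1"
    using TU by (simp add: fps_compose_mult_distrib fps_compose_power fps_compose_sub_distrib)
  moreover have "F\<^sup>2 * ((1 - A)\<^sup>2 - 4 * T) =
      (H oo (T * U\<^sup>2))\<^sup>2 * ((U * (1 - A))\<^sup>2 - 4 * (T * U\<^sup>2))"
    unfolding F_def H_def[symmetric] by (simp add: power2_eq_square algebra_simps)
  ultimately show "F\<^sup>2 * ((1 - A)\<^sup>2 - 4 * T) = 1"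
    by (simp add: U)
  show "F $ 0 = 1" by (simp add: F_def U_def A0)
  have "F $ n = (\<Sum>k\<le>n. H $ k * (U * (T * U\<^sup>2) ^ k) $ n)"
    unfolding F_def H_def[symmetric] by (rule fps_mult_compose_nth[OF TU order_refl])
  also have "\<dots> = (\<Sum>k\<le>n. H $ k * (T ^ k * U ^ Suc (2 * k)) $ n)"
    by (simp add: power_mult_distrib power_mult mult.left_commute)
  also have "\<dots> = (\<Sum>k\<le>n. H $ k * (\<Sum>j\<le>n. of_nat ((2*k + j) choose j) * (T ^ k * A ^ j) $ n))"
    unfolding U_def inverse_one_minus_power_compose[OF A0] fps_mult_compose_nth[OF A0 order_refl]
    by simp
  also have "\<dots> = (\<Sum>k\<le>n. \<Sum>j\<le>n. of_nat (((2*k+j) choose k) * ((k+j) choose k)) * (T ^ k * A ^ j) $ n)"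
    unfolding central_binomial_times_binomial[symmetric] H_def by (simp add: sum_distrib_left mult.assoc)
  finally show "F $ n = (\<Sum>k\<le>n. \<Sum>j\<le>n. of_nat (((2*k+j) choose k) * ((k+j) choose k)) * (T ^ k * A ^ j) $ n)" .
qed

section \<open>Extracting and reindexing coefficients\<close>

text \<open>After X^(3k+j) is factored out, the remaining degree splits into r from the j-th power
  and the rest from the k-th power. The range of r is empty when n < 3k + j, whereas a bound with
  truncated subtraction would keep r = 0.\<close>

lemma linear_powers_mult_nth:
  fixes a1 a2 a3 a4 :: "'a::comm_ring_1"
  shows "(((fps_const a3 + fps_const a4 * fps_X) * fps_X ^ 3) ^ k
     * (fps_const a1 * fps_X + fps_const a2 * fps_X\<^sup>2) ^ j) $ n =
    (\<Sum>r | 3 * k + j + r \<le> n. of_nat (j choose r) * of_nat (k choose (n - (3 * k + j) - r))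
       * a1 ^ (j - r) * a2 ^ r * a3 ^ (k - (n - (3 * k + j) - r)) * a4 ^ (n - (3 * k + j) - r))"
proof -
  have "fps_const a1 * fps_X + fps_const a2 * fps_X\<^sup>2 = fps_X * (fps_const a1 + fps_const a2 * fps_X)"
    by (simp add: power2_eq_square algebra_simps)
  then have eq: "((fps_const a3 + fps_const a4 * fps_X) * fps_X ^ 3) ^ k
     * (fps_const a1 * fps_X + fps_const a2 * fps_X\<^sup>2) ^ j =
     fps_X ^ (3 * k + j) * ((fps_const a1 + fps_const a2 * fps_X) ^ j
       * (fps_const a3 + fps_const a4 * fps_X) ^ k)"
    by (simp only: power_mult_distrib power_add power_mult ac_simps flip: power_mult)
  show ?thesis
  proof (cases "n < 3 * k + j")
    case False
    then have "{r. 3 * k + j + r \<le> n} = {0..n - (3 * k + j)}" by auto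
    with False show ?thesis
      unfolding eq fps_X_power_mult_nth
      by (simp add: fps_mult_nth fps_linear_power_nth) (simp add: mult_ac)
  qed (simp add: eq fps_X_power_mult_nth)
qed

text \<open>This is the substitution \<open>m = 2k + j\<close>.\<close>

lemma sum_reindex_linear_form:
  fixes g :: "nat \<Rightarrow> nat \<Rightarrow> 'a::comm_monoid_add"
  assumes "\<And>k j. g k j \<noteq> 0 \<Longrightarrow> 3 * k + j \<le> n \<and> n \<le> 2 * (2 * k + j)"
  shows "(\<Sum>k\<le>n. \<Sum>j\<le>n. g k j) = (\<Sum>m = n div 2..n. \<Sum>k = 0..m div 2. g k (m - 2 * k))"
proof -
  have "(\<Sum>k\<le>n. \<Sum>j\<le>n. g k j) = (\<Sum>(k, j)\<in>{..n} \<times> {..n}. g k j)"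
    by (simp add: sum.cartesian_product)
  also have "\<dots> = (\<Sum>(m, k)\<in>(SIGMA m:{n div 2..n}. {0..m div 2}). g k (m - 2 * k))"
  \<comment> \<open>The map (k, j) to (2k + j, k) need only match nonzero terms. For these, the
    assumption yields n div 2 <= 2k + j <= n.\<close>
  proof (rule sum.reindex_bij_witness_not_neutral[where
        S' = "{(k, j). (k, j) \<in> {..n} \<times> {..n} \<and> g k j = 0}"
        and T' = "{(m, k). (m, k) \<in> (SIGMA m:{n div 2..n}. {0..m div 2}) \<and> g k (m - 2 * k) = 0}"
        and i = "\<lambda>(m, k). (k, m - 2 * k)" and j = "\<lambda>(k, j). (2 * k + j, k)"])
    show "finite {(k, j). (k, j) \<in> {..n} \<times> {..n} \<and> g k j = 0}"
      by (rule finite_subset[of _ "{..n} \<times> {..n}"]) auto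
    show "finite {(m, k). (m, k) \<in> (SIGMA m:{n div 2..n}. {0..m div 2}) \<and> g k (m - 2 * k) = 0}"
      by (rule finite_subset[of _ "SIGMA m:{n div 2..n}. {0..m div 2}"]) auto
  qed (use assms in \<open>fastforce+\<close>)
  also have "\<dots> = (\<Sum>m = n div 2..n. \<Sum>k = 0..m div 2. g k (m - 2 * k))"
    by (simp add: sum.Sigma)
  finally show ?thesis .
qed

section \<open>The coefficient formula\<close>

theorem invariant_differential_expansion:
  fixes a1 a2 a3 a4 :: "'a::field_char_0"
  shows "invariant_differential a1 a2 a3 a4 = fps_to_fls (Abs_fps (\<lambda>n.
      \<Sum>m = n div 2..n. \<Sum>k = 0..m div 2. \<Sum>r | m + k + r \<le> n.
        of_nat (m choose k) * of_nat ((m - k) choose k) * of_nat ((m - 2 * k) choose r)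
          * of_nat (k choose (n - m - k - r))
          * a1 ^ (m - 2 * k - r) * a2 ^ r * a3 ^ (2 * k + m + r - n) * a4 ^ (n - m - k - r)))"
    (is "_ = fps_to_fls (Abs_fps ?b)")
proof -
  define A where "A = fps_const a1 * fps_X + fps_const a2 * fps_X\<^sup>2"
  define C where "C = fps_const a3 + fps_const a4 * fps_X"
  define T where "T = C * fps_X ^ 3"
  define v where "v = w_series a1 a2 a3 a4"
  define S where "S = 1 - A - 2 * C * v"
  define F where "F = inverse (1 - A)
    * (Abs_fps (\<lambda>k. of_nat ((2 * k) choose k)) oo (T * (inverse (1 - A))\<^sup>2))"
  have A0: "A $ 0 = 0" and T0: "T $ 0 = 0"
    by (simp_all add: A_def T_def)
  note F = inverse_sqrt_quadratic_series[OF A0 T0, folded F_def]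
  have "v $ 0 = 0"
    using is_w_series_w_series[of a1 a2 a3 a4] by (simp add: v_def is_w_series_def)
  then have S0: "S $ 0 = 1" by (simp add: S_def A0)
  have "v = fps_X ^ 3 + A * v + C * v\<^sup>2"
    using is_w_series_w_series[of a1 a2 a3 a4]
    by (simp add: is_w_series_def A_def C_def v_def algebra_simps)
  then have "fps_X ^ 3 = v - A * v - C * v\<^sup>2"
    by (simp add: algebra_simps)
  then have T: "T = C * (v - A * v - C * v\<^sup>2)"
    by (simp add: T_def)
  \<comment> \<open>With z^3 eliminated through the equation for \<open>v\<close>, this is
    completing the square.\<close>
  have "S\<^sup>2 = (1 - A)\<^sup>2 - 4 * T"
    unfolding T S_def by (simp add: power2_eq_square algebra_simps)
  then have "(F * S)\<^sup>2 = 1"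
    using F(1) by (simp add: power_mult_distrib)
  then have "F * S = 1"
    by (rule fps_eq_1_if_square_eq_1) (simp add: F(2) S0)
  then have "invariant_differential a1 a2 a3 a4 = fps_to_fls F"
    by (intro invariant_differential_eqI) (simp add: S_def A_def C_def v_def diff_diff_eq)
  moreover have "F = Abs_fps ?b"
  proof (rule fps_ext)
    fix n :: nat
    define g where "g k j = of_nat (((2*k+j) choose k) * ((k+j) choose k)) * (T ^ k * A ^ j) $ n"
      for k j
    note g = g_def[unfolded T_def C_def A_def linear_powers_mult_nth]
    have "F $ n = (\<Sum>k\<le>n. \<Sum>j\<le>n. g k j)"
      unfolding g_def by (rule F(3))
    also have "\<dots> = (\<Sum>m = n div 2..n. \<Sum>k = 0..m div 2. g k (m - 2 * k))"
    proof (rule sum_reindex_linear_form)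
      fix k j assume "g k j \<noteq> 0"
      \<comment> \<open>Nonzero binomials force r <= j and n - (3k + j) - r <= k, which add up to n
        <= 4k + 2j.\<close>
      then obtain r where "3 * k + j + r \<le> n" "j choose r \<noteq> 0"
          "k choose (n - (3 * k + j) - r) \<noteq> 0"
        unfolding g by (auto elim!: sum.not_neutral_contains_not_neutral)
      then show "3 * k + j \<le> n \<and> n \<le> 2 * (2 * k + j)"
        by (auto simp: binomial_eq_0_iff)
    qed
    also have "\<dots> = ?b n"
    proof (intro sum.cong refl)
      fix m k :: nat assume "k \<in> {0..m div 2}"
      then have m: "2 * k + (m - 2 * k) = m" "k + (m - 2 * k) = m - k" "3 * k + (m - 2 * k) = m + k"
        by auto
      show "g k (m - 2 * k) = (\<Sum>r | m + k + r \<le> n.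
        of_nat (m choose k) * of_nat ((m - k) choose k) * of_nat ((m - 2 * k) choose r)
          * of_nat (k choose (n - m - k - r))
          * a1 ^ (m - 2 * k - r) * a2 ^ r * a3 ^ (2 * k + m + r - n) * a4 ^ (n - m - k - r))"
        unfolding g m sum_distrib_left
      proof (intro sum.cong refl)
        fix r assume "r \<in> {r. m + k + r \<le> n}"
        \<comment> \<open>Both forms of the exponent of \<open>a3\<close> truncate to 0 together,
          exactly when the integer exponent would be negative; there the last binomial coefficient
          vanishes.\<close>
        then have "k - (n - (m + k) - r) = 2 * k + m + r - n" "n - (m + k) - r = n - m - k - r"
          by auto
        then show "of_nat ((m choose k) * ((m - k) choose k)) * (of_nat ((m - 2 * k) choose r)
            * of_nat (k choose (n - (m + k) - r)) * a1 ^ (m - 2 * k - r) * a2 ^ r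
            * a3 ^ (k - (n - (m + k) - r)) * a4 ^ (n - (m + k) - r)) =
          of_nat (m choose k) * of_nat ((m - k) choose k) * of_nat ((m - 2 * k) choose r)
            * of_nat (k choose (n - m - k - r))
            * a1 ^ (m - 2 * k - r) * a2 ^ r * a3 ^ (2 * k + m + r - n) * a4 ^ (n - m - k - r)"
          by (simp only: of_nat_mult mult.assoc)
      qed
    qed
    finally show "F $ n = Abs_fps ?b $ n" by simp
  qed
  ultimately show ?thesis by simp
qed

text \<open>The expansion over the rationals; every summand is the image of an integer, so
  \<open>of_int\<close> can be taken outside the sums.\<close>

theorem theorem3:
  fixes a1 a2 a3 a4 :: int
  assumes "elliptic_curve (of_int a1 :: rat) (of_int a2) (of_int a3) (of_int a4)"
  shows "invariant_differential (of_int a1 :: rat) (of_int a2) (of_int a3) (of_int a4) =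
    fps_to_fls (Abs_fps (\<lambda>n. of_int (
      \<Sum>m = n div 2..n. \<Sum>k = 0..m div 2. \<Sum>r | m + k + r \<le> n.
        int (m choose k) * int ((m - k) choose k) * int ((m - 2 * k) choose r)
          * int (k choose (n - m - k - r))
          * a1 ^ (m - 2 * k - r) * a2 ^ r * a3 ^ (2 * k + m + r - n) * a4 ^ (n - m - k - r))))"
  unfolding invariant_differential_expansion by simp

end
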